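(* Let $n\ge5$ and let $S_n\in\mathbb{S}_n$ satisfy $R_n\Rightarrow S_n$, with sorted non-decreasing codeword length sequence $(l_1,\dots,l_n)$. If $\sum_{i=1}^n l_i<n(n+1)/2$, then $S_n\in\mathbb{D}_n$.
   Context: All strings are finite binary strings; $|w|$ denotes length. A palindrome is a string equal to its reversal. A symmetric fix-free code is a finite set of binary palindromes no one of which is a proper prefix of another. $\mathbb{S}_n$ is the set of symmetric fix-free codes with exactly $n$ codewords which do not contain the string $1$ and all of whose codewords have length at most $n$. $R_n=\{s_1,\dots,s_n\}$ with $s_1=0$ and $s_i=1\,0^{i-2}\,1$ for $2\le i\le n$. For a palindrome $\sigma$, $\mathcal{N}(\sigma)$ is the set of palindromes $w$ such that $\sigma$ is the longest palindrome that is a proper prefix of $w$, and $\mathcal{N}_n(\sigma)=\{w\in\mathcal{N}(\sigma):|w|\le n\}$. $R_n\Rightarrow S$ means: for some $j$, $S$ is an $n$-element subset of $(R_n\cup\mathcal{N}_n(s_j))\setminus\{s_j\}$ such that no word of that set outside $S$ is shorter than any word of $S$. A sorted non-decreasing length sequence $(l_1,\dots,l_n)$ dominates $(l_1',\dots,l_n')$ if $\sum_{j=1}^i l_j'\ge\sum_{j=1}^i l_j$ for every $i\in\{1,\dots,n\}$. $\mathbb{D}_n\subseteq\mathbb{S}_n$ is the set of codes in $\mathbb{S}_n$ whose sorted non-decreasing codeword length sequence is not dominated by the sorted non-decreasing codeword length sequence of any other code in $\mathbb{S}_n$ (with a different length sequence). *)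

theory Defs
  imports Main "HOL-Library.Multiset" "HOL-Library.Sublist"
begin

text \<open>Binary strings are lists of booleans: False encodes 0, True encodes 1.\<close>

type_synonym bstr = "bool list"

definition palindrome :: "bstr \<Rightarrow> bool" where
  "palindrome w \<longleftrightarrow> rev w = w"

definition sym_fix_free :: "bstr set \<Rightarrow> bool" where
  "sym_fix_free C \<longleftrightarrow> finite C \<and> (\<forall>w\<in>C. palindrome w) \<and>
     (\<forall>u\<in>C. \<forall>v\<in>C. \<not> strict_prefix u v)"

definition SS :: "nat \<Rightarrow> bstr set set" where
  "SS n = {C. sym_fix_free C \<and> card C = n \<and> [True] \<notin> C \<and> (\<forall>w\<in>C. length w \<le> n)}"

definition sw :: "nat \<Rightarrow> bstr" where
  "sw i = (if i = 1 then [False] else True # replicate (i - 2) False @ [True])"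

definition RR :: "nat \<Rightarrow> bstr set" where
  "RR n = sw ` {1..n}"

definition NN :: "bstr \<Rightarrow> bstr set" where
  "NN \<sigma> = {w. palindrome w \<and> palindrome \<sigma> \<and> strict_prefix \<sigma> w \<and>
              (\<forall>u. palindrome u \<and> strict_prefix u w \<longrightarrow> length u \<le> length \<sigma>)}"

definition NNn :: "nat \<Rightarrow> bstr \<Rightarrow> bstr set" where
  "NNn n \<sigma> = {w \<in> NN \<sigma>. length w \<le> n}"

definition derives :: "nat \<Rightarrow> bstr set \<Rightarrow> bool" where
  "derives n S \<longleftrightarrow> (\<exists>j\<in>{1..n}.
     let T = (RR n \<union> NNn n (sw j)) - {sw j} in
       S \<subseteq> T \<and> card S = n \<and>
       (\<forall>w\<in>T - S. \<forall>v\<in>S. \<not> length w < length v))"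

definition lenseq :: "bstr set \<Rightarrow> nat list" where
  "lenseq C = sorted_list_of_multiset (image_mset length (mset_set C))"

definition dominates :: "nat list \<Rightarrow> nat list \<Rightarrow> bool" where
  "dominates l l' \<longleftrightarrow> length l = length l' \<and>
     (\<forall>i\<in>{1..length l}. sum_list (take i l) \<le> sum_list (take i l'))"

definition DD :: "nat \<Rightarrow> bstr set set" where
  "DD n = {C \<in> SS n. \<not> (\<exists>C'\<in>SS n. lenseq C' \<noteq> lenseq C \<and> dominates (lenseq C') (lenseq C))}"

end

theory Submission
  imports Defs
begin

text \<open>For a code C put slack(C, m) as the sum of max 0 (m - |w|) over w in C.  If C dominates S,
  then slack(S, m) \<le> slack(C, m) for every m, so it suffices to find an m with slack(C, m) < slack(S, m).
  Let S be derived by expanding the base word s_j.  If s_j is not in C, every word of C extends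
  a word of the set from which S picks the n shortest, and the shortest such word missing in C
  gives m; if none is missing below the maximal length of S, the length sequences agree.
  If s_j is in C, then C can only expand some s_i with i > j.  The palindromes extending s_i are
  1 0...0 z 0...0 1 with i - 2 zeros on either side and z a palindrome starting with 1, so their
  lengths for i are those for j shifted by 2 (i - j), whereas giving up s_i instead of s_j only
  saves i - j.  Hence no expansion in C has gained on R_n at the first m where S has (up to a
  correction, as both codes are limited to n words), and such an m exists because S has a
  smaller total length than R_n.\<close>

section \<open>Slack of a code as a function of m\<close>

definition slack :: "bstr set \<Rightarrow> nat \<Rightarrow> nat" where
  "slack C m = (\<Sum>w\<in>C. m - length w)"

lemma slack_mono_set: "finite D \<Longrightarrow> C \<subseteq> D \<Longrightarrow> slack C m \<le> slack D m"
  unfolding slack_def by (rule sum_mono2) auto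

lemma slack_add_le: "slack C (m + d) \<le> slack C m + card C * d"
proof -
  have "slack C (m + d) \<le> (\<Sum>w\<in>C. (m - length w) + d)"
    unfolding slack_def by (rule sum_mono) auto
  then show ?thesis by (simp add: slack_def sum.distrib)
qed

text \<open>Once m reaches the longest word nothing is truncated, so slack grows at its maximal rate
  \<open>card C\<close>.\<close>

lemma slack_add_eq:
  assumes "\<And>w. w \<in> C \<Longrightarrow> length w \<le> m"
  shows "slack C (m + d) = slack C m + card C * d"
proof -
  have "slack C (m + d) = (\<Sum>w\<in>C. (m - length w) + d)"
    unfolding slack_def using assms by (intro sum.cong) auto
  then show ?thesis by (simp add: slack_def sum.distrib)
qed

lemma slack_total:
  assumes "finite C" "\<And>w. w \<in> C \<Longrightarrow> length w \<le> m"
  shows "slack C m + (\<Sum>w\<in>C. length w) = card C * m"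
proof -
  have "slack C m + (\<Sum>w\<in>C. length w) = (\<Sum>w\<in>C. (m - length w) + length w)"
    by (simp add: slack_def sum.distrib)
  also have "\<dots> = (\<Sum>w\<in>C. m)" using assms(2) by (intro sum.cong) auto
  finally show ?thesis by simp
qed

subsection \<open>Dominance of length sequences\<close>

text \<open>In a sorted list the entries below m form an initial segment, and only they survive the
  truncation.\<close>

lemma sum_list_diff_take_sorted:
  fixes xs :: "nat list" and m :: nat
  assumes "sorted xs"
  defines "i \<equiv> length (takeWhile (\<lambda>l. l < m) xs)"
  shows "sum_list (map ((-) m) xs) + sum_list (take i xs) = m * i"
  using assms(1) unfolding i_def
proof (induction xs)
  case (Cons x xs)
  show ?case
  proof (cases "x < m")
    case True
    then show ?thesis using Cons by simp
  next
    case False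
    then have "\<forall>l\<in>set xs. m - l = 0" using Cons.prems by auto
    then have "map ((-) m) xs = map (\<lambda>_. 0) xs" by simp
    then show ?thesis using False by (simp add: sum_list_triv)
  qed
qed simp

lemma sum_list_diff_take:
  fixes xs :: "nat list"
  shows "i \<le> length xs \<Longrightarrow> m * i \<le> sum_list (map ((-) m) xs) + sum_list (take i xs)"
proof (induction xs arbitrary: i)
  case (Cons x xs)
  then show ?case by (cases i) (force simp: algebra_simps)+
qed simp

lemma mset_lenseq: "mset (lenseq C) = image_mset length (mset_set C)"
  by (simp add: lenseq_def)

lemma sum_list_map_lenseq: "sum_list (map f (lenseq C)) = (\<Sum>w\<in>C. f (length w) :: nat)"
proof -
  have "sum_list (map f (lenseq C)) = sum_mset (image_mset f (mset (lenseq C)))"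
    by (metis mset_map sum_mset_sum_list)
  also have "\<dots> = (\<Sum>w\<in>C. f (length w))"
    by (simp add: mset_lenseq sum_unfold_sum_mset image_mset.compositionality comp_def)
  finally show ?thesis .
qed

lemma sum_list_lenseq: "sum_list (lenseq C) = (\<Sum>w\<in>C. length w)"
  using sum_list_map_lenseq[of "\<lambda>x. x"] by simp

lemma sorted_lenseq: "sorted (lenseq C)"
  by (simp add: lenseq_def)

text \<open>At a given m, the sum of the truncated differences is the maximum over i of
  m * i minus the i-th partial sum.\<close>

lemma dominates_slack:
  assumes "dominates (lenseq C) (lenseq S)"
  shows "slack S m \<le> slack C m"
proof -
  define i where "i = length (takeWhile (\<lambda>l. l < m) (lenseq S))"
  have len: "length (lenseq C) = length (lenseq S)"
    using assms by (simp add: dominates_def)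
  have i: "i \<le> length (lenseq S)" by (simp add: i_def length_takeWhile_le)
  \<comment> \<open>\<open>dominates\<close> starts at index 1; for \<open>i = 0\<close> both sums
    vanish.\<close>
  have le: "sum_list (take i (lenseq C)) \<le> sum_list (take i (lenseq S))"
    using assms i len by (cases "i = 0") (auto simp: dominates_def)
  have "slack S m + sum_list (take i (lenseq S)) = m * i"
    using sum_list_diff_take_sorted[OF sorted_lenseq, of m S]
    by (simp add: i_def slack_def sum_list_map_lenseq)
  also have "\<dots> \<le> slack C m + sum_list (take i (lenseq C))"
    using sum_list_diff_take[of i "lenseq C" m] i len
    by (simp add: slack_def sum_list_map_lenseq)
  finally show ?thesis using le by linarith
qed

lemma dominates_sum:
  assumes "dominates (lenseq C) (lenseq S)"
  shows "(\<Sum>w\<in>C. length w) \<le> (\<Sum>w\<in>S. length w)"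
proof (cases "lenseq C = []")
  case True
  then show ?thesis by (metis sum_list.Nil sum_list_lenseq zero_le)
next
  case False
  then have "length (lenseq C) \<in> {1..length (lenseq C)}"
    by (cases "lenseq C") auto
  then have "sum_list (take (length (lenseq C)) (lenseq C))
      \<le> sum_list (take (length (lenseq C)) (lenseq S))"
    using assms unfolding dominates_def by blast
  then show ?thesis using assms by (simp add: dominates_def sum_list_lenseq)
qed

text \<open>Shortest missing word: at its length plus one its deletion costs 1,
  while all its extensions are still too long to contribute.\<close>

lemma slack_greedy:
  assumes "finite E" "v \<in> E" "v \<notin> C"
    and below: "\<And>e. e \<in> E \<Longrightarrow> length e < length v \<Longrightarrow> e \<in> C"
    and cover: "\<And>w. w \<in> C \<Longrightarrow> \<exists>e\<in>E. prefix e w"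
    and anti: "\<And>u w. u \<in> C \<Longrightarrow> w \<in> C \<Longrightarrow> \<not> strict_prefix u w"
    and "finite C"
  shows "slack C (Suc (length v)) < slack E (Suc (length v))"
proof -
  let ?m = "Suc (length v)"
  let ?C = "{w \<in> C. length w < ?m}"
  have sub: "?C \<subseteq> E - {v}"
  proof
    fix w assume w: "w \<in> ?C"
    then obtain e where e: "e \<in> E" "prefix e w" using cover by auto
    have "e = w"
    proof (rule ccontr)
      assume "e \<noteq> w"
      then have sp: "strict_prefix e w" using e by (simp add: strict_prefix_def)
      then have "length e < length w" by (rule prefix_length_less)
      then have "e \<in> C" using below e w by auto
      then show False using anti sp w by auto
    qed
    then show "w \<in> E - {v}" using e w assms by auto
  qed
  have "slack C ?m = slack ?C ?m" unfolding slack_def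
    using \<open>finite C\<close> by (intro sum.mono_neutral_right) auto
  also have "\<dots> \<le> slack (E - {v}) ?m" using sub assms(1) by (intro slack_mono_set) auto
  also have "\<dots> < slack E ?m" unfolding slack_def
    using assms(1,2) by (simp add: sum.remove[of E v])
  finally show ?thesis .
qed

subsection \<open>Extensions of the words of the base code\<close>

text \<open>With \<open>k = i - 2\<close> and z starting with 1, that leading 1 closes an initial
  copy of \<open>sw i\<close>.\<close>

definition wrap :: "nat \<Rightarrow> bstr \<Rightarrow> bstr" where
  "wrap k z = True # replicate k False @ z @ replicate k False @ [True]"

text \<open>The bound is strict so that for \<open>y = m + 2 - 2 * i\<close> these are exactly the
  cores z for which \<open>wrap (i - 2) z\<close> is shorter than m.\<close>

definition pal1 :: "nat \<Rightarrow> bstr set" where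
  "pal1 y = {z. palindrome z \<and> z \<noteq> [] \<and> hd z \<and> length z < y}"

text \<open>With \<open>y = m + 2 - 2 * i\<close> this is the slack at m of all palindromes properly
  extending \<open>sw i\<close>. Depending on y alone, it makes different i comparable by a shift of
  m.\<close>

definition ext_slack :: "nat \<Rightarrow> nat" where
  "ext_slack y = slack (pal1 y) y"

lemma length_wrap: "length (wrap k z) = length z + 2 * (k + 1)"
  by (simp add: wrap_def)

lemma inj_wrap: "inj (wrap k)"
  by (auto simp: wrap_def inj_def)

lemma palindrome_wrap: "palindrome (wrap k z) \<longleftrightarrow> palindrome z"
  by (auto simp: wrap_def palindrome_def)

lemma length_sw: "i \<ge> 1 \<Longrightarrow> length (sw i) = i"
  by (auto simp: sw_def)

lemma inj_on_sw: "inj_on sw {1..n}"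
  by (rule inj_onI) (metis atLeastAtMost_iff length_sw)

lemma palindrome_sw: "palindrome (sw i)"
  by (simp add: palindrome_def sw_def)

lemma strict_prefix_sw_wrap:
  assumes "i \<ge> 2" "z \<noteq> []" "hd z"
  shows "strict_prefix (sw i) (wrap (i - 2) z)"
proof -
  obtain z' where z: "z = True # z'" using assms by (cases z) auto
  show ?thesis using assms(1)
    by (auto simp: sw_def wrap_def z strict_prefix_def prefix_def)
qed

text \<open>Write w as p followed by t, where p is 1 0...0 and t starts with 1, and compare with the
  reversal. If \<open>rev t\<close> lay inside p, its last letter 1 would meet a 0 of p. Hence t
  ends in \<open>rev p\<close>, and the rest of t is the core.\<close>

lemma pal_ext_imp_wrap:
  assumes "i \<ge> 2" "palindrome w" "strict_prefix (sw i) w"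
  shows "\<exists>z. w = wrap (i - 2) z \<and> palindrome z \<and> z \<noteq> [] \<and> hd z"
proof -
  define k where "k = i - 2"
  define p where "p = True # replicate k False"
  have swp: "sw i = p @ [True]" using assms(1) by (simp add: sw_def k_def p_def)
  obtain r where r: "w = p @ True # r" "r \<noteq> []"
    using assms(3) unfolding swp by (auto simp: strict_prefix_def prefix_def)
  have p_nth: "\<not> p ! x" if "0 < x" "x < length p" for x
    using that by (cases x) (auto simp: p_def)
  define t where "t = True # r"
  have "p @ t = rev t @ rev p"
    using assms(2) r(1) by (simp add: palindrome_def t_def)
  then consider us where "p = rev t @ us" | us where "p @ us = rev t" "t = us @ rev p"
    by (auto simp: append_eq_append_conv2)
  then show ?thesis
  proof cases
    case 1
    then have "p ! length r" by (simp add: t_def nth_append)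
    moreover have "length r < length p" using 1 by (simp add: t_def)
    ultimately show ?thesis using p_nth r(2) by blast
  next
    case 2
    \<comment> \<open>An empty core means \<open>p = rev t\<close>, which fails for the same
      reason.\<close>
    have "us \<noteq> []"
    proof
      assume "us = []"
      then have "p = rev r @ [True]" using 2 by (simp add: t_def)
      then have "p ! length r" "length r < length p" by (simp_all add: nth_append)
      then show False using p_nth r(2) by blast
    qed
    moreover have "hd us" using 2(2) \<open>us \<noteq> []\<close> by (metis hd_append2 list.sel(1) t_def)
    moreover have "p @ us = p @ rev us" using 2 by simp
    moreover have "w = wrap k us" using r(1) 2(2) by (simp add: wrap_def t_def p_def)
    ultimately show ?thesis by (auto simp: palindrome_def k_def)
  qed
qed

lemma finite_pal1: "finite (pal1 y)"
proof (rule finite_subset)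
  show "pal1 y \<subseteq> {z. set z \<subseteq> UNIV \<and> length z \<le> y}" by (auto simp: pal1_def)
qed (rule finite_lists_length_le, simp)

lemma pal1_mono: "y \<le> y' \<Longrightarrow> pal1 y \<subseteq> pal1 y'"
  by (auto simp: pal1_def)

lemma pal1_3: "pal1 3 = {[True], [True, True]}"
proof -
  have "z \<in> {[True], [True, True]}" if "z \<in> pal1 3" for z
  proof -
    have z: "rev z = z" "z \<noteq> []" "hd z" "length z < 3"
      using that by (simp_all add: pal1_def palindrome_def)
    then consider "length z = Suc 0" | "length z = Suc (Suc 0)"
      by (cases "length z"; cases "length z - 1"; force)
    then show ?thesis
      by cases (use z(1,3) in \<open>auto simp: length_Suc_conv\<close>)
  qed
  then show ?thesis by (auto simp: pal1_def palindrome_def)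
qed

text \<open>Only the cores 1 and 11 are short enough, contributing (y - 1) + (y - 2).\<close>

lemma ext_slack_le:
  assumes "y \<le> 3"
  shows "ext_slack y \<le> y"
proof -
  have "ext_slack y \<le> slack (pal1 3) y"
    unfolding ext_slack_def by (rule slack_mono_set[OF finite_pal1 pal1_mono[OF assms]])
  also have "\<dots> \<le> y" using assms by (auto simp: pal1_3 slack_def)
  finally show ?thesis .
qed

text \<open>The cores 1, 11, 101 and 111 alone contribute 4 y - 9, which exceeds 2 y - 2 from y = 4
  on.\<close>

lemma ext_slack_ge:
  assumes "y \<ge> 4"
  shows "ext_slack y > 2 * y - 2"
proof -
  let ?Z = "{[True], [True, True], [True, False, True], [True, True, True]}"
  have "?Z \<subseteq> pal1 y" using assms by (simp add: pal1_def palindrome_def)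
  then have "slack ?Z y \<le> ext_slack y"
    unfolding ext_slack_def by (rule slack_mono_set[OF finite_pal1])
  moreover have "slack ?Z y = (y - 1) + ((y - 2) + ((y - 3) + (y - 3)))"
    by (simp add: slack_def numeral_eq_Suc)
  ultimately show ?thesis using assms by linarith
qed

lemma slack_ext_le:
  assumes "i \<ge> 2" "finite D" "\<And>w. w \<in> D \<Longrightarrow> palindrome w \<and> strict_prefix (sw i) w"
  shows "slack D m \<le> ext_slack (m + 2 - 2 * i)"
proof -
  let ?y = "m + 2 - 2 * i"
  let ?D = "{w \<in> D. length w < m}"
  have sub: "?D \<subseteq> wrap (i - 2) ` pal1 ?y"
  proof
    fix w assume w: "w \<in> ?D"
    then obtain z where z: "w = wrap (i - 2) z" "palindrome z" "z \<noteq> []" "hd z"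
      using pal_ext_imp_wrap[of i w] assms by auto
    have "length z < ?y" using w z(1) assms(1) by (auto simp: length_wrap)
    then show "w \<in> wrap (i - 2) ` pal1 ?y" using z by (auto simp: pal1_def)
  qed
  have "slack D m = slack ?D m" unfolding slack_def
    using assms(2) by (intro sum.mono_neutral_right) auto
  also have "\<dots> \<le> slack (wrap (i - 2) ` pal1 ?y) m"
    using sub by (intro slack_mono_set finite_imageI finite_pal1)
  also have "\<dots> = (\<Sum>z\<in>pal1 ?y. m - length (wrap (i - 2) z))"
    unfolding slack_def by (subst sum.reindex) (auto intro: inj_on_subset[OF inj_wrap])
  also have "\<dots> = ext_slack ?y"
    unfolding ext_slack_def slack_def
    using assms(1) by (intro sum.cong) (auto simp: length_wrap)
  finally show ?thesis .
qed

text \<open>A palindromic prefix u of w is also a suffix of w, so w carries a second copy of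
  1 0...0 1 starting at position length w - length u.  Two such copies
  overlap in at most one letter.\<close>

lemma wrap_in_NN:
  assumes "i \<ge> 2" "palindrome z" "z \<noteq> []" "hd z" "length (wrap (i - 2) z) < 3 * i - 2"
  shows "wrap (i - 2) z \<in> NN (sw i)"
proof -
  let ?w = "wrap (i - 2) z"
  have pw: "palindrome ?w" using assms(2) by (simp add: palindrome_wrap)
  have sp: "strict_prefix (sw i) ?w" using assms by (intro strict_prefix_sw_wrap)
  have "length u \<le> length (sw i)" if u: "palindrome u" "strict_prefix u ?w" for u
  proof (rule ccontr)
    assume c: "\<not> length u \<le> length (sw i)"
    have "prefix (sw i) u"
      using sp u(2) c by (meson prefix_length_prefix nat_le_linear strict_prefix_def)
    then have "strict_prefix (sw i) u" using c by (auto simp: strict_prefix_def)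
    then obtain y where y: "u = wrap (i - 2) y" "y \<noteq> []"
      using pal_ext_imp_wrap[OF assms(1) u(1)] by auto
    have lu: "length u \<ge> 2 * i - 1"
      using y assms(1) by (cases y) (auto simp: length_wrap)
    obtain x where x: "?w = u @ x" "x \<noteq> []"
      using u(2) by (auto simp: strict_prefix_def prefix_def)
    have "?w = rev x @ u"
      using pw u(1) x(1) by (metis palindrome_def rev_append)
    then have "?w ! length x = u ! 0"
      using nth_append_length_plus[of "rev x" u 0] by simp
    then have at: "?w ! length x" using y(1) by (simp add: wrap_def)
    \<comment> \<open>Positions 1 to i - 2 of the word hold 0, so the second copy cannot start
      there.\<close>
    have "length x \<ge> i - 1"
    proof (rule ccontr)
      assume short: "\<not> length x \<ge> i - 1"
      obtain l where l: "length x = Suc l" using x(2) by (cases x) auto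
      have "l < i - 2" using short l by linarith
      then show False using at l by (simp add: wrap_def nth_append)
    qed
    then have "length ?w \<ge> 3 * i - 2" using x(1) lu assms(1) by simp
    then show False using assms(5) by simp
  qed
  then show ?thesis using pw sp by (auto simp: NN_def palindrome_sw)
qed


subsection \<open>Symmetric fix-free codes\<close>

lemma SS_D:
  assumes "C \<in> SS n"
  shows "finite C" "card C = n" "[True] \<notin> C"
    "\<And>w. w \<in> C \<Longrightarrow> palindrome w" "\<And>w. w \<in> C \<Longrightarrow> length w \<le> n"
    "\<And>u w. u \<in> C \<Longrightarrow> w \<in> C \<Longrightarrow> \<not> strict_prefix u w"
  using assms by (auto simp: SS_def sym_fix_free_def)

text \<open>A palindrome starting with 1 ends with 1, so unless it is 1 itself it contains a second
  1. The zeros between its first two ones determine i.\<close>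

lemma palindrome_sw_prefix:
  assumes "palindrome w" "w \<noteq> []" "w \<noteq> [True]"
  shows "\<exists>i\<in>{1..length w}. prefix (sw i) w"
proof (cases "hd w")
  case False
  then have "prefix (sw 1) w" using assms(2) by (cases w) (auto simp: sw_def)
  then show ?thesis using assms(2) by (intro bexI[of _ 1]) (auto simp: Suc_le_eq)
next
  case True
  then obtain t where t: "w = True # t" using assms(2) by (cases w) auto
  have "t \<noteq> []" using t assms(3) by auto
  have "last w" using assms(1) True by (metis hd_rev palindrome_def)
  then have "last t = True" using t \<open>t \<noteq> []\<close> by simp
  then have "True \<in> set t" using last_in_set[OF \<open>t \<noteq> []\<close>] by metis
  then obtain ys zs where yz: "t = ys @ True # zs" "True \<notin> set ys"
    by (meson split_list_first)
  have "ys = replicate (length ys) False"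
    using yz(2) by (metis (full_types) replicate_eqI)
  then have "sw (length ys + 2) = True # ys @ [True]" by (simp add: sw_def)
  then show ?thesis using t yz(1)
    by (intro bexI[of _ "length ys + 2"]) (auto simp: prefix_def)
qed

text \<open>For 1 < i < i' the letter at position i - 1 is 1 in \<open>sw i\<close> but 0 in
  \<open>sw i'\<close>; for i = 1 the first letters differ.\<close>

lemma sw_prefix_unique:
  assumes "i \<ge> 1" "i' \<ge> 1" "prefix (sw i) (sw i')"
  shows "i = i'"
proof (rule ccontr)
  assume ne: "i \<noteq> i'"
  have "i \<le> i'" using assms prefix_length_le[OF assms(3)] by (simp add: length_sw)
  then have lt: "i < i'" using ne by simp
  have "sw i' ! x = sw i ! x" if "x < i" for x
    using assms(1,3) that by (auto simp: prefix_def nth_append length_sw)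
  then have eq: "sw i' ! (i - 1) = sw i ! (i - 1)" using assms(1) by simp
  show False
  proof (cases "i = 1")
    case True
    then show ?thesis using eq lt by (simp add: sw_def)
  next
    case False
    then obtain k where k: "i = Suc (Suc k)" using assms(1) by (metis One_nat_def Suc_pred' le_eq_less_or_eq not0_implies_Suc not_one_le_zero)
    then have "k < i' - 2" using lt by simp
    then show ?thesis using eq lt k by (simp add: sw_def nth_append)
  qed
qed

lemma SS_sw_prefix:
  assumes "C \<in> SS n" "n \<ge> 2" "w \<in> C"
  shows "\<exists>i\<in>{1..n}. prefix (sw i) w"
proof -
  have "w \<noteq> []"
  proof
    assume "w = []"
    \<comment> \<open>The empty word is a proper prefix of every other word, so it would be the only
      codeword.\<close>
    have "C \<subseteq> {[]}"
      using SS_D(6)[OF assms(1) assms(3)] \<open>w = []\<close> by (auto simp: strict_prefix_def)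
    then have "card C \<le> 1" using card_mono[of "{[]}" C] by simp
    then show False using assms SS_D(2) by force
  qed
  moreover have "w \<noteq> [True]" using assms SS_D(3) by blast
  ultimately obtain i where "i \<in> {1..length w}" "prefix (sw i) w"
    using palindrome_sw_prefix SS_D(4)[OF assms(1,3)] by blast
  then show ?thesis using SS_D(5)[OF assms(1,3)] by (intro bexI[of _ i]) auto
qed

text \<open>Each codeword extends exactly one \<open>sw i\<close>, so C splits into disjoint
  branches that can be bounded separately.\<close>

lemma slack_SS_split:
  assumes "C \<in> SS n" "n \<ge> 2"
  shows "slack C m = (\<Sum>i\<in>{1..n}. slack {w \<in> C. prefix (sw i) w} m)"
proof -
  have "C = (\<Union>i\<in>{1..n}. {w \<in> C. prefix (sw i) w})"
    using SS_sw_prefix[OF assms] by auto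
  then have "slack C m = sum (\<lambda>w. m - length w) (\<Union>i\<in>{1..n}. {w \<in> C. prefix (sw i) w})"
    by (simp add: slack_def)
  also have "\<dots> = (\<Sum>i\<in>{1..n}. slack {w \<in> C. prefix (sw i) w} m)"
    unfolding slack_def
  proof (rule sum.UNION_disjoint)
    show "\<forall>i\<in>{1..n}. \<forall>i'\<in>{1..n}. i \<noteq> i' \<longrightarrow>
        {w \<in> C. prefix (sw i) w} \<inter> {w \<in> C. prefix (sw i') w} = {}"
    proof (intro ballI impI)
      fix i i' assume i: "i \<in> {1..n}" "i' \<in> {1..n}" "i \<noteq> i'"
      have False if "prefix (sw i) w" "prefix (sw i') w" for w
        using prefix_same_cases[OF that] sw_prefix_unique[of i i'] sw_prefix_unique[of i' i] i
        by auto
      then show "{w \<in> C. prefix (sw i) w} \<inter> {w \<in> C. prefix (sw i') w} = {}" by blast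
    qed
  qed (use SS_D(1)[OF assms(1)] in auto)
  finally show ?thesis .
qed

lemma slack_branch_in:
  assumes "C \<in> SS n" "sw i \<in> C" "i \<ge> 1"
  shows "slack {w \<in> C. prefix (sw i) w} m = m - i"
proof -
  have "{w \<in> C. prefix (sw i) w} = {sw i}"
    using assms SS_D(6)[OF assms(1,2)] by (auto simp: strict_prefix_def)
  then show ?thesis using assms(3) by (simp add: slack_def length_sw)
qed

lemma slack_branch_notin:
  assumes "C \<in> SS n" "sw i \<notin> C" "i \<ge> 2"
  shows "slack {w \<in> C. prefix (sw i) w} m \<le> ext_slack (m + 2 - 2 * i)"
  using assms SS_D[OF assms(1)] by (intro slack_ext_le) (auto simp: strict_prefix_def)

lemma slack_RR: "slack (RR n) m = (\<Sum>i\<in>{1..n}. m - i)"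
  unfolding slack_def RR_def
  by (subst sum.reindex[OF inj_on_sw]) (auto intro!: sum.cong simp: length_sw)

section \<open>The pool of words for a derived code, and its slack\<close>

lemma finite_NNn: "finite (NNn n \<sigma>)"
proof (rule finite_subset)
  show "NNn n \<sigma> \<subseteq> {w. set w \<subseteq> UNIV \<and> length w \<le> n}" by (auto simp: NNn_def)
qed (rule finite_lists_length_le, simp)

lemma finite_RR: "finite (RR n)"
  by (simp add: RR_def)

text \<open>Take the shortest palindromic prefix of w properly extending \<open>\<sigma>\<close>: no
  palindrome lies strictly between.\<close>

lemma NN_prefix:
  assumes "palindrome w" "strict_prefix \<sigma> w" "palindrome \<sigma>"
  shows "\<exists>u\<in>NN \<sigma>. prefix u w"
proof -
  define P where "P u \<longleftrightarrow> palindrome u \<and> strict_prefix \<sigma> u \<and> prefix u w" for u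
  have "P w" using assms by (simp add: P_def)
  then obtain u where u: "P u" and least: "\<And>v. P v \<Longrightarrow> length u \<le> length v"
    using ex_has_least_nat[of P w length] by blast
  have "length v \<le> length \<sigma>" if v: "palindrome v" "strict_prefix v u" for v
  proof (rule ccontr)
    assume c: "\<not> length v \<le> length \<sigma>"
    have "prefix \<sigma> v"
      using u v(2) c unfolding P_def
      by (meson prefix_length_prefix nat_le_linear strict_prefix_def)
    then have "strict_prefix \<sigma> v" using c by (auto simp: strict_prefix_def)
    moreover have "prefix v w"
      using u v(2) unfolding P_def by (auto simp: strict_prefix_def intro: prefix_order.trans)
    ultimately have "P v" using v by (simp add: P_def)
    then show False using least[of v] prefix_length_less[OF v(2)] by simp
  qed
  then show ?thesis using u assms(3) unfolding P_def NN_def by blast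
qed

text \<open>The pool from which a code obtained by expanding \<open>sw j\<close> takes its n
  shortest words.\<close>

definition base :: "nat \<Rightarrow> nat \<Rightarrow> bstr set" where
  "base n j = (RR n \<union> NNn n (sw j)) - {sw j}"

lemma finite_base: "finite (base n j)"
  by (simp add: base_def finite_RR finite_NNn)

lemma SS_base_prefix:
  assumes "C \<in> SS n" "n \<ge> 2" "sw j \<notin> C" "w \<in> C"
  shows "\<exists>e\<in>base n j. prefix e w"
proof -
  obtain i where i: "i \<in> {1..n}" "prefix (sw i) w" using SS_sw_prefix assms by blast
  show ?thesis
  proof (cases "sw i = sw j")
    case False
    then show ?thesis using i by (intro bexI[of _ "sw i"]) (auto simp: base_def RR_def)
  next
    case True
    then have "strict_prefix (sw j) w" using i assms(3,4) by (auto simp: strict_prefix_def)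
    then obtain u where u: "u \<in> NN (sw j)" "prefix u w"
      using NN_prefix SS_D(4)[OF assms(1,4)] palindrome_sw by blast
    have "length u \<le> n" using prefix_length_le[OF u(2)] SS_D(5)[OF assms(1,4)] by simp
    moreover have "u \<noteq> sw j" using u(1) by (auto simp: NN_def)
    ultimately show ?thesis using u by (intro bexI[of _ u]) (auto simp: base_def NNn_def)
  qed
qed

text \<open>Expanding \<open>sw j\<close> costs \<open>m - j\<close>. As long as
  \<open>m \<le> 3 * j - 2\<close>, all palindromic extensions shorter than m lie in
  \<open>NN (sw j)\<close>, so the full \<open>ext_slack\<close> is gained. The additive form avoids
  truncated subtraction.\<close>

lemma slack_base_ge:
  assumes "j \<in> {1..n}" "j \<ge> 2" "m \<le> n" "m \<le> 3 * j - 2"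
  shows "slack (RR n) m + ext_slack (m + 2 - 2 * j) \<le> slack (base n j) m + (m - j)"
proof -
  let ?y = "m + 2 - 2 * j" and ?W = "wrap (j - 2) ` pal1 (m + 2 - 2 * j)"
  have len: "length (wrap (j - 2) z) < m" if "z \<in> pal1 ?y" for z
    using that assms(2) by (auto simp: pal1_def length_wrap)
  have W: "?W \<subseteq> NNn n (sw j)"
  proof
    fix w assume "w \<in> ?W"
    then obtain z where z: "z \<in> pal1 ?y" "w = wrap (j - 2) z" by auto
    have "w \<in> NN (sw j)" unfolding z(2)
      using z(1) assms len[OF z(1)] by (intro wrap_in_NN) (auto simp: pal1_def)
    then show "w \<in> NNn n (sw j)" using len[OF z(1)] z(2) assms(3) by (simp add: NNn_def)
  qed
  have sj: "sw j \<in> RR n" using assms(1) by (auto simp: RR_def)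
  have disj: "(RR n - {sw j}) \<inter> ?W = {}"
  proof -
    have "sw i \<notin> ?W" if "i \<in> {1..n}" for i
    proof
      assume "sw i \<in> ?W"
      then have "strict_prefix (sw j) (sw i)" using W by (auto simp: NNn_def NN_def)
      then show False using sw_prefix_unique[of j i] that assms(1)
        by (auto simp: strict_prefix_def)
    qed
    then show ?thesis unfolding RR_def by blast
  qed
  have "slack ?W m = (\<Sum>z\<in>pal1 ?y. m - length (wrap (j - 2) z))"
    unfolding slack_def by (subst sum.reindex) (auto intro: inj_on_subset[OF inj_wrap])
  also have "\<dots> = ext_slack ?y" unfolding ext_slack_def slack_def
    using assms(2) by (intro sum.cong) (auto simp: length_wrap)
  finally have sW: "slack ?W m = ext_slack ?y" .
  have "slack (RR n) m + ext_slack ?y = (m - j) + slack (RR n - {sw j}) m + slack ?W m"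
    using sum.remove[OF finite_RR sj, of "\<lambda>w. m - length w"] assms(1)
    unfolding sW by (simp add: slack_def length_sw)
  also have "\<dots> = (m - j) + slack ((RR n - {sw j}) \<union> ?W) m"
    unfolding slack_def using disj
    by (subst sum.union_disjoint) (auto simp: finite_RR finite_pal1)
  also have "\<dots> \<le> (m - j) + slack (base n j) m"
  proof -
    have "sw j \<notin> NNn n (sw j)" by (simp add: NNn_def NN_def)
    then have "(RR n - {sw j}) \<union> ?W \<subseteq> base n j" using W unfolding base_def by blast
    then show ?thesis by (simp add: slack_mono_set finite_base)
  qed
  finally show ?thesis by simp
qed

lemma sw_in_base: "i \<in> {1..n} \<Longrightarrow> j \<ge> 1 \<Longrightarrow> i \<noteq> j \<Longrightarrow> sw i \<in> base n j"
  using sw_prefix_unique[of i j] unfolding base_def RR_def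
  by (metis Diff_iff UnI1 atLeastAtMost_iff imageI prefix_order.refl singletonD)

text \<open>Reduces membership to a finite check on initial segments, which evaluation can settle
  for concrete words.\<close>

lemma NN_I:
  assumes "palindrome w" "palindrome \<sigma>" "strict_prefix \<sigma> w"
    and "list_all (\<lambda>k. \<not> palindrome (take k w)) [Suc (length \<sigma>)..<length w]"
  shows "w \<in> NN \<sigma>"
proof -
  have "length u \<le> length \<sigma>" if u: "palindrome u" "strict_prefix u w" for u
  proof (rule ccontr)
    assume c: "\<not> length u \<le> length \<sigma>"
    have take: "take (length u) w = u" using u(2) by (auto simp: strict_prefix_def prefix_def)
    have "length u \<in> set [Suc (length \<sigma>)..<length w]"
      using prefix_length_less[OF u(2)] c by simp
    then have "\<not> palindrome (take (length u) w)"
      using assms(4) unfolding list_all_iff by blast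
    then show False using u(1) take by simp
  qed
  then show ?thesis using assms by (auto simp: NN_def)
qed

lemma NN_in_base:
  assumes "w \<in> NN (sw j)" "length w \<le> n"
  shows "w \<in> base n j"
  using assms by (auto simp: base_def NNn_def NN_def)

lemma slack_RR_square:
  assumes "m \<le> n"
  shows "2 * slack (RR n) m = m * (m - 1)"
proof -
  have "slack (RR n) m = (\<Sum>i\<in>{1..m}. m - i)"
    unfolding slack_RR using assms by (intro sum.mono_neutral_right) auto
  then have "slack (RR n) m + \<Sum>{1..m} = (\<Sum>i\<in>{1..m}. (m - i) + i)"
    unfolding sum.distrib by (rule arg_cong)
  also have "\<dots> = (\<Sum>i\<in>{1..m}. m)" by (intro sum.cong) auto
  also have "\<dots> = m * m" by simp
  finally have "slack (RR n) m + \<Sum>{1..m} = m * m" .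
  moreover have "2 * \<Sum>{1..m} = m * (m + 1)" using gauss_sum_from_Suc_0[of m, where 'a = nat] by simp
  ultimately show ?thesis by (cases m) (auto simp: algebra_simps)
qed

text \<open>Exchange argument: each word of \<open>W - S\<close> is at least as long as the longest
  word of S, so it contributes at most K, whereas each word of \<open>S - W\<close> contributes at
  least K, and there are at least as many of the latter.\<close>

lemma slack_shortest:
  assumes "finite T" "S \<subseteq> T" "W \<subseteq> T" "card W \<le> card S"
    and shortest: "\<And>w v. w \<in> T - S \<Longrightarrow> v \<in> S \<Longrightarrow> length v \<le> length w"
  shows "slack W m \<le> slack S m"
proof (cases "S = {}")
  case True
  then have "W = {}" using assms by (simp add: finite_subset)
  then show ?thesis by (simp add: slack_def)
next
  case False
  have fin: "finite S" "finite W" using assms finite_subset by auto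
  define K where "K = m - Max (length ` S)"
  have "card (W - S) \<le> card (S - W)"
    using card_Diff_subset_Int[of W S] card_Diff_subset_Int[of S W] fin assms(4)
    by (simp add: Int_commute card_mono)
  have "slack (W - S) m \<le> (\<Sum>w\<in>W - S. K)"
    unfolding slack_def K_def using shortest assms(3) fin False
    by (intro sum_mono diff_le_mono2) auto
  also have "\<dots> \<le> (\<Sum>w\<in>S - W. K)" using \<open>card (W - S) \<le> card (S - W)\<close> by simp
  also have "\<dots> \<le> slack (S - W) m"
    unfolding slack_def K_def using fin by (intro sum_mono diff_le_mono2) auto
  finally have "slack (W - S) m \<le> slack (S - W) m" .
  moreover have "slack W m = slack (W \<inter> S) m + slack (W - S) m"
    unfolding slack_def by (rule sum.Int_Diff[OF fin(2)])
  moreover have "slack S m = slack (W \<inter> S) m + slack (S - W) m"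
    unfolding slack_def using sum.Int_Diff[OF fin(1), of _ W] by (simp add: Int_commute)
  ultimately show ?thesis by simp
qed

section \<open>Comparison of an arbitrary code with the derived code\<close>

lemma slack_le_RR:
  assumes "C \<in> SS n" "n \<ge> 2"
    and "\<And>i. i \<in> {1..n} \<Longrightarrow> sw i \<notin> C \<Longrightarrow> i \<ge> 2 \<and> ext_slack (m + 2 - 2 * i) \<le> m - i"
  shows "slack C m \<le> slack (RR n) m"
  unfolding slack_SS_split[OF assms(1,2)] slack_RR
proof (rule sum_mono)
  fix i assume i: "i \<in> {1..n}"
  show "slack {w \<in> C. prefix (sw i) w} m \<le> m - i"
  proof (cases "sw i \<in> C")
    case True
    then show ?thesis using slack_branch_in[OF assms(1)] i by simp
  next
    case False
    then show ?thesis using slack_branch_notin[OF assms(1) False] assms(3)[OF i False]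
      by (meson order_trans)
  qed
qed

text \<open>Explicit pool words beat m (m - 1) / 2, the slack of \<open>RR n\<close>: 11 > 10 at m =
  5, 22 > 21 at m = 7 and 29 > 28 at m = 8. If n is too small for the witness, \<open>m = n\<close>
  meets the bound. The bound \<open>2 * j + 3\<close> keeps \<open>m + 2 - 2 * i\<close> at most 3
  for every i > j.\<close>

lemma slack_small_witness:
  assumes "n \<ge> 5" "j \<in> {1..3}"
    and opt: "\<And>W m. W \<subseteq> base n j \<Longrightarrow> card W \<le> n \<Longrightarrow> slack W m \<le> slack S m"
    and total: "slack (RR n) n < slack S n"
  shows "\<exists>m\<le>2 * j + 3. slack (RR n) m < slack S m"
proof -
  have *: ?thesis if "W \<subseteq> base n j" "card W \<le> n" "m \<le> n" "m \<le> 2 * j + 3"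
    "m * (m - 1) < 2 * slack W m" for W m
    using opt[OF that(1,2), of m] slack_RR_square[OF that(3)] that(4,5)
    by (intro exI[of _ m]) linarith
  consider "j = 1" | "j = 2" | "j = 3" using assms(2) by force
  then show ?thesis
  proof cases
    case 1
    let ?W = "{sw 2, sw 3, [False, False], [False, True, False], [False, True, True, False]}"
    have NN: "[False, False] \<in> NN (sw 1)" "[False, True, False] \<in> NN (sw 1)"
      "[False, True, True, False] \<in> NN (sw 1)"
      by (rule NN_I; code_simp)+
    have "?W \<subseteq> base n j"
        using NN[THEN NN_in_base, of n] sw_in_base[of _ n j] assms(1) 1 by simp
    moreover have "card ?W = 5" "slack ?W 5 = 11" by code_simp+
    ultimately show ?thesis using assms(1) 1 by (intro *[of ?W 5]) auto
  next
    case 2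
    show ?thesis
    proof (cases "n \<ge> 7")
      case True
      let ?W = "{sw 1, sw 3, sw 4, sw 5, [True, True, True],
        [True, True, False, True, True], [True, True, False, False, True, True]}"
      have NN: "[True, True, True] \<in> NN (sw 2)" "[True, True, False, True, True] \<in> NN (sw 2)"
        "[True, True, False, False, True, True] \<in> NN (sw 2)"
        by (rule NN_I; code_simp)+
      have "?W \<subseteq> base n j"
        using NN[THEN NN_in_base, of n] sw_in_base[of _ n j] True 2 by simp
    moreover have "card ?W = 7" "slack ?W 7 = 22" by code_simp+
      ultimately show ?thesis using True 2 by (intro *[of ?W 7]) auto
    qed (use total 2 in \<open>intro exI[of _ n], auto\<close>)
  next
    case 3
    show ?thesis
    proof (cases "n \<ge> 9")
      case True
      let ?W = "{sw 1, sw 2, sw 4, sw 5, sw 6, sw 7, [True, False, True, False, True],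
        [True, False, True, True, False, True], [True, False, True, True, True, False, True]}"
      have NN: "[True, False, True, False, True] \<in> NN (sw 3)"
        "[True, False, True, True, False, True] \<in> NN (sw 3)"
        "[True, False, True, True, True, False, True] \<in> NN (sw 3)"
        by (rule NN_I; code_simp)+
      have "?W \<subseteq> base n j"
        using NN[THEN NN_in_base, of n] sw_in_base[of _ n j] True 3 by simp
    moreover have "card ?W = 9" "slack ?W 8 = 29" by code_simp+
      ultimately show ?thesis using True 3 by (intro *[of ?W 8]) auto
    qed (use total 3 in \<open>intro exI[of _ n], auto\<close>)
  qed
qed

text \<open>Let q = i - j for the shortest missing word of length i.  Up to L + 2 q no branch of C
  gains anything by m'; beyond, C is charged the maximal rate n per step, which is the rate S
  attains already from L on.\<close>

lemma slack_deficit_large: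
  assumes "n \<ge> 5" "j \<in> {4..n}" "C \<in> SS n" "card S = n"
    and opt: "\<And>W m. W \<subseteq> base n j \<Longrightarrow> card W \<le> n \<Longrightarrow> slack W m \<le> slack S m"
    and le_L: "\<And>w. w \<in> S \<Longrightarrow> length w \<le> L"
    and upto_L: "\<And>m. m \<le> L \<Longrightarrow> slack (base n j) m \<le> slack S m"
    and total: "slack (RR n) n < slack S n"
    and miss: "\<And>i. i \<in> {1..n} \<Longrightarrow> sw i \<notin> C \<Longrightarrow> i > j"
  shows "\<exists>m. slack C m < slack S m"
proof -
  define m where "m = (LEAST m. slack (RR n) m < slack S m)"
  have gain: "slack (RR n) m < slack S m" unfolding m_def using total by (rule LeastI)
  have m_le: "m \<le> n" unfolding m_def using total by (rule Least_le)
  have before: "slack S m' \<le> slack (RR n) m'" if "m' < m" for m'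
    using not_less_Least[OF that[unfolded m_def]] by simp
  \<comment> \<open>Up to L the code S has the slack of the whole pool, so before m expanding
    \<open>sw j\<close> has not paid off.\<close>
  have ext: "ext_slack (m' + 2 - 2 * j) \<le> m' - j"
    if "m' < m" "m' \<le> L" "m' \<le> 3 * j - 2" for m'
    using slack_base_ge[of j n m'] before[OF that(1)] upto_L[OF that(2)] that m_le assms(2)
    by fastforce
  \<comment> \<open>At 3 j - 2 the expansion would already have paid off by
    \<open>ext_slack_ge\<close>, so the range condition of \<open>ext\<close> holds
    automatically.\<close>
  have short: "m' < 3 * j - 2" if "m' < m" "m' \<le> L" for m'
  proof (rule ccontr)
    assume "\<not> m' < 3 * j - 2"
    then have "ext_slack ((3 * j - 2) + 2 - 2 * j) \<le> (3 * j - 2) - j"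
      using that by (intro ext) auto
    moreover have "(3 * j - 2) + 2 - 2 * j = j" "(3 * j - 2) - j = 2 * j - 2"
      using assms(2) by auto
    moreover have "ext_slack j > 2 * j - 2"
      by (rule ext_slack_ge) (use assms(2) in simp)
    ultimately show False by (metis not_le)
  qed
  have branch: "ext_slack (x + 2 - 2 * i) \<le> x - i"
    if "x \<le> m" "x \<le> L + 2 * (i - j)" "i > j" for x i
  proof (cases "x < 2 * (i - j)")
    case True
    then have "x + 2 - 2 * i = 0" using assms(2) that(3) by auto
    moreover have "ext_slack 0 = 0" using ext_slack_le[of 0] by simp
    ultimately show ?thesis by (metis zero_le)
  next
    case False
    \<comment> \<open>Shifting back by 2 (i - j) keeps the argument of \<open>ext_slack\<close> and
      turns the cost for i into a smaller one for j.\<close>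
    define m' where "m' = x - 2 * (i - j)"
    have x: "x = m' + 2 * (i - j)" using False by (simp add: m'_def)
    have m': "m' < m" "m' \<le> L" using x that by auto
    have "x + 2 - 2 * i = m' + 2 - 2 * j" using x that(3) by simp
    then have "ext_slack (x + 2 - 2 * i) \<le> m' - j"
      using ext[OF m'] short[OF m'] by simp
    also have "\<dots> \<le> x - i" using x that(3) by simp
    finally show ?thesis .
  qed
  show ?thesis
  proof (cases "\<forall>i\<in>{1..n}. sw i \<notin> C \<longrightarrow> m \<le> L + 2 * (i - j)")
    case True
    have "slack C m \<le> slack (RR n) m"
      using assms(1,2,3) True branch miss by (intro slack_le_RR) fastforce+
    then show ?thesis using gain by (intro exI[of _ m]) simp
  next
    case False
    define P where "P i \<longleftrightarrow> i \<in> {1..n} \<and> sw i \<notin> C \<and> L + 2 * (i - j) < m" for i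
    \<comment> \<open>The least such i gives the smallest M, so at M every other branch is still
      covered by \<open>branch\<close>.\<close>
    obtain i0 where "P i0" using False by (auto simp: P_def not_le)
    then obtain i where i: "P i" and least: "\<And>i'. P i' \<Longrightarrow> i \<le> i'"
      using ex_has_least_nat[of P _ "\<lambda>i. i"] by blast
    have i': "i \<in> {1..n}" "sw i \<notin> C" "i > j" using i miss by (auto simp: P_def)
    define q where "q = i - j"
    define M where "M = L + 2 * q"
    have q: "q \<ge> 1" "i = j + q" using i'(3) by (auto simp: q_def)
    have n2: "n \<ge> 2" using assms(1) by simp
    have M: "M < m" using i by (simp add: P_def M_def q_def)
    have L: "L < 3 * j - 2" using short[of L] M by (simp add: M_def)
    have branch_le: "slack {w \<in> C. prefix (sw i') w} M \<le> M - i'"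
      if a: "i' \<in> {1..n} - {i}" for i'
    proof (cases "sw i' \<in> C")
      case True
      then show ?thesis using slack_branch_in[OF assms(3)] a by simp
    next
      case False
      have "i' > j" using miss a False by simp
      moreover have "M \<le> L + 2 * (i' - j)"
      proof (rule ccontr)
        assume c: "\<not> M \<le> L + 2 * (i' - j)"
        then have "P i'" using a False M by (simp add: P_def)
        then have "i \<le> i'" by (rule least)
        then show False using c by (simp add: M_def q_def)
      qed
      ultimately have "ext_slack (M + 2 - 2 * i') \<le> M - i'" using branch M by simp
      moreover have "i' \<ge> 2" using \<open>i' > j\<close> assms(2) by simp
      ultimately show ?thesis using slack_branch_notin[OF assms(3) False, of M] by simp
    qed
    have "M + 2 - 2 * i = L + 2 - 2 * j" using q by (simp add: M_def)
    then have branch_i: "slack {w \<in> C. prefix (sw i) w} M \<le> ext_slack (L + 2 - 2 * j)"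
      using slack_branch_notin[OF assms(3) i'(2), of M] i'(3) assms(2) by simp
    have "slack C M = slack {w \<in> C. prefix (sw i) w} M
        + (\<Sum>i'\<in>{1..n} - {i}. slack {w \<in> C. prefix (sw i') w} M)"
      unfolding slack_SS_split[OF assms(3) n2] by (rule sum.remove[OF _ i'(1)]) simp
    moreover have "slack (RR n) M = (M - i) + (\<Sum>i'\<in>{1..n} - {i}. M - i')"
      unfolding slack_RR by (rule sum.remove[OF _ i'(1)]) simp
    moreover have "(\<Sum>i'\<in>{1..n} - {i}. slack {w \<in> C. prefix (sw i') w} M)
        \<le> (\<Sum>i'\<in>{1..n} - {i}. M - i')"
      by (rule sum_mono[OF branch_le])
    ultimately have C_M: "slack C M + (M - i) \<le> ext_slack (L + 2 - 2 * j) + slack (RR n) M"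
      using branch_i by linarith
    \<comment> \<open>Strictness comes from the index n: since M < n, its left term is 0 while the
      right one is at least 2 q.\<close>
    have "slack (RR n) M < (\<Sum>i\<in>{1..n}. (L - i) + 2 * q)"
      unfolding slack_RR using M m_le q assms(1)
      by (intro sum_strict_mono_ex1 bexI[of _ n]) (auto simp: M_def)
    then have RR_M: "slack (RR n) M < slack (RR n) L + n * (2 * q)"
      by (simp add: slack_RR sum.distrib)
    have "slack (RR n) L + ext_slack (L + 2 - 2 * j) \<le> slack (base n j) L + (L - j)"
      using assms(2) L M m_le by (intro slack_base_ge) (auto simp: M_def)
    then have S_L: "slack (RR n) L + ext_slack (L + 2 - 2 * j) \<le> slack S L + (L - j)"
      using upto_L[of L] by simp
    have "L - j \<le> M - i" using q by (simp add: M_def)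
    then have *: "slack C M < slack S L + n * (2 * q)"
      using C_M RR_M S_L by linarith
    have "slack C m \<le> slack C M + n * (m - M)"
      using slack_add_le[of C M "m - M"] SS_D(2)[OF assms(3)] M by simp
    also have "\<dots> < slack S L + n * (2 * q) + n * (m - M)" using * by simp
    also have "\<dots> = slack S L + n * (2 * q + (m - M))" by (simp only: distrib_left add.assoc)
    also have "2 * q + (m - M) = m - L" using M by (simp add: M_def)
    also have "slack S L + n * (m - L) = slack S m"
      using slack_add_eq[of S L "m - L"] le_L assms(4) M by (simp add: M_def)
    finally show ?thesis by blast
  qed
qed

text \<open>Beyond the common words, S has only words of length L and C equally many of length at
  least L; the bound on the sums forces equality.\<close>

lemma lenseq_eqI:
  assumes "finite C" "finite S" "card C = card S"
    and low: "{w \<in> C. length w < L} = {w \<in> S. length w < L}"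
    and "\<And>w. w \<in> S \<Longrightarrow> length w \<le> L"
    and sum_le: "(\<Sum>w\<in>C. length w) \<le> (\<Sum>w\<in>S. length w)"
  shows "lenseq C = lenseq S"
proof -
  let ?P = "{w \<in> S. length w < L}"
  have PC: "?P \<subseteq> C" using low by blast
  have PS: "?P \<subseteq> S" by blast
  have S_L: "length w = L" if "w \<in> S - ?P" for w using that assms(5)[of w] by auto
  have C_ge: "length w \<ge> L" if "w \<in> C - ?P" for w
    using that low by (metis (mono_tags, lifting) DiffE linorder_not_le mem_Collect_eq)
  have card: "card (C - ?P) = card (S - ?P)"
    using assms(1-3) PC PS by (simp add: card_Diff_subset finite_subset)
  have "(\<Sum>w\<in>C - ?P. length w) \<le> (\<Sum>w\<in>S - ?P. length w)"
    using sum_le sum.subset_diff[OF PC assms(1), of length]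
      sum.subset_diff[OF PS assms(2), of length] by simp
  also have "\<dots> = (\<Sum>w\<in>S - ?P. L)" by (rule sum.cong[OF refl S_L])
  also have "\<dots> = card (C - ?P) * L" using card by simp
  finally have le: "(\<Sum>w\<in>C - ?P. length w) \<le> (\<Sum>w\<in>C - ?P. L)" by simp
  have C_L: "length w = L" if w: "w \<in> C - ?P" for w
  proof (rule ccontr)
    assume "length w \<noteq> L"
    then have "(\<Sum>w\<in>C - ?P. L) < (\<Sum>w\<in>C - ?P. length w)"
      using w C_ge assms(1) by (intro sum_strict_mono_ex1) (auto simp: le_less)
    then show False using le by simp
  qed
  have const: "image_mset length (mset_set D) = replicate_mset (card D) L"
    if "finite D" "\<And>w. w \<in> D \<Longrightarrow> length w = L" for D :: "bstr set"
  proof -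
    have "image_mset length (mset_set D) = image_mset (\<lambda>_. L) (mset_set D)"
      using that by (intro image_mset_cong) auto
    then show ?thesis using that(1) by (simp add: image_mset_const_eq)
  qed
  have split: "mset_set D = mset_set ?P + mset_set (D - ?P)" if "finite D" "?P \<subseteq> D" for D
    using that by (metis (no_types, lifting) Diff_disjoint Un_Diff_cancel finite_Diff
        finite_subset mset_set_Union sup.absorb2)
  have "image_mset length (mset_set (C - ?P)) = image_mset length (mset_set (S - ?P))"
    by (simp only: const[OF finite_Diff[OF assms(1)] C_L] const[OF finite_Diff[OF assms(2)] S_L] card)
  then show ?thesis
    unfolding lenseq_def split[OF assms(1) PC] split[OF assms(2) PS] by simp
qed

theorem theorem7:
  fixes n :: nat and S :: "bool list set"
  assumes "n \<ge> 5"
    and "S \<in> SS n"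
    and "derives n S"
    and "2 * sum_list (lenseq S) < n * (n + 1)"
  shows "S \<in> DD n"
proof -
  obtain j where j: "j \<in> {1..n}" "S \<subseteq> base n j"
    and shortest: "\<And>w v. w \<in> base n j - S \<Longrightarrow> v \<in> S \<Longrightarrow> length v \<le> length w"
    using assms(3) unfolding derives_def base_def Let_def by (meson not_less)
  note S = SS_D[OF assms(2)]
  have "S \<noteq> {}" using S(2) assms(1) by auto
  define L where "L = Max (length ` S)"
  have le_L: "length w \<le> L" if "w \<in> S" for w using that S(1) by (simp add: L_def)
  have "L \<in> length ` S" unfolding L_def using S(1) \<open>S \<noteq> {}\<close> by (intro Max_in) auto
  \<comment> \<open>S contains a word of length L, so it cannot omit a shorter pool word.\<close>
  then have base_L: "w \<in> S" if "w \<in> base n j" "length w < L" for w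
    using shortest that by fastforce
  have opt: "slack W m \<le> slack S m" if "W \<subseteq> base n j" "card W \<le> n" for W m
    using that S(2) j(2) shortest by (intro slack_shortest[OF finite_base]) auto
  have upto_L: "slack (base n j) m \<le> slack S m" if "m \<le> L" for m
  proof -
    have "slack (base n j) m = slack {w \<in> base n j. length w < m} m"
      unfolding slack_def by (intro sum.mono_neutral_right) (auto simp: finite_base)
    also have "\<dots> \<le> slack S m" using base_L that S(1) by (intro slack_mono_set) auto
    finally show ?thesis .
  qed
  \<comment> \<open>At m = n slack and total length add up to n * n, so a smaller total length means
    a larger slack.\<close>
  have total: "slack (RR n) n < slack S n"
  proof -
    have "slack S n + (\<Sum>w\<in>S. length w) = n * n" using slack_total[of S n] S by simp
    moreover have "2 * (\<Sum>w\<in>S. length w) < n * (n + 1)" using assms(4) by (simp add: sum_list_lenseq)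
    moreover have "2 * slack (RR n) n + n * (n + 1) = 2 * (n * n)"
      using slack_RR_square[of n n] by (cases n) auto
    ultimately show ?thesis by linarith
  qed
  have "lenseq C = lenseq S" if C: "C \<in> SS n" "dominates (lenseq C) (lenseq S)" for C
  proof (cases "sw j \<in> C")
    case False
    \<comment> \<open>A shortest missing v has \<open>Suc (length v) \<le> L\<close>, where S still
      has the slack of the pool; C would fall short there.\<close>
    have base_C: "w \<in> C" if w: "w \<in> base n j" "length w < L" for w
    proof (rule ccontr)
      define P where "P v \<longleftrightarrow> v \<in> base n j \<and> length v < L \<and> v \<notin> C" for v
      assume "w \<notin> C"
      then have "P w" using w by (simp add: P_def)
      then obtain v where v: "P v" "\<And>u. P u \<Longrightarrow> length v \<le> length u"
        using ex_has_least_nat[of P w length] by blast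
      have "slack C (Suc (length v)) < slack (base n j) (Suc (length v))"
      proof (rule slack_greedy[OF finite_base])
        show "e \<in> C" if "e \<in> base n j" "length e < length v" for e
          using v(1) v(2)[of e] that by (auto simp: P_def)
      qed (use v(1) SS_base_prefix[OF C(1) _ False] assms(1) SS_D[OF C(1)] in \<open>auto simp: P_def\<close>)
      also have "\<dots> \<le> slack S (Suc (length v))" using v(1) by (intro upto_L) (simp add: P_def)
      also have "\<dots> \<le> slack C (Suc (length v))" by (rule dominates_slack[OF C(2)])
      finally show False by simp
    qed
    have C_base: "w \<in> base n j" if w: "w \<in> C" "length w < L" for w
    proof -
      obtain e where e: "e \<in> base n j" "prefix e w"
        using SS_base_prefix[OF C(1) _ False w(1)] assms(1) by auto
      then have "e \<in> C" using base_C[of e] w(2) prefix_length_le[OF e(2)] by simp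
      then have "e = w" using SS_D(6)[OF C(1) _ w(1)] e(2) by (auto simp: strict_prefix_def)
      then show ?thesis using e(1) by simp
    qed
    show ?thesis
    proof (rule lenseq_eqI[where L = L])
      show "{w \<in> C. length w < L} = {w \<in> S. length w < L}"
        using base_L base_C C_base j(2) by blast
    qed (use S SS_D[OF C(1)] le_L dominates_sum[OF C(2)] in auto)
  next
    case True
    \<comment> \<open>If the least missing index k were below j, then at \<open>Suc k\<close> only
      \<open>sw 1\<close> to \<open>sw k\<close> count in \<open>RR n\<close>, and all of them are
      available to S.\<close>
    have miss: "i > j" if i: "i \<in> {1..n}" "sw i \<notin> C" for i
    proof (rule ccontr)
      assume "\<not> i > j"
      define P where "P i \<longleftrightarrow> i \<in> {1..n} \<and> sw i \<notin> C" for i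
      have "P i" using i by (simp add: P_def)
      then obtain k where k: "P k" "\<And>i. P i \<Longrightarrow> k \<le> i"
        using ex_has_least_nat[of P i "\<lambda>i. i"] by blast
      have "k \<le> i" using k(2) \<open>P i\<close> .
      moreover have "k \<noteq> j" using k(1) True by (auto simp: P_def)
      ultimately have "k < j" using \<open>\<not> i > j\<close> by simp
      have len: "length (sw k) = k" using k(1) by (simp add: length_sw P_def)
      have "slack C (Suc k) < slack (RR n) (Suc k)"
      proof (rule slack_greedy[OF finite_RR, of "sw k", unfolded len])
        show "e \<in> C" if e: "e \<in> RR n" "length e < k" for e
        proof -
          obtain i where "i \<in> {1..n}" "e = sw i" using e(1) by (auto simp: RR_def)
          then show ?thesis using k(2)[of i] e(2) by (auto simp: P_def length_sw)
        qed
        show "\<exists>e\<in>RR n. prefix e w" if "w \<in> C" for w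
          using SS_sw_prefix[OF C(1) _ that] assms(1) by (auto simp: RR_def)
      qed (use k(1) SS_D[OF C(1)] in \<open>auto simp: P_def RR_def\<close>)
      also have "\<dots> = slack (sw ` {1..k}) (Suc k)"
        unfolding slack_def RR_def using k(1)
        by (intro sum.mono_neutral_right) (auto simp: P_def length_sw)
      also have "\<dots> \<le> slack S (Suc k)"
      proof (rule opt)
        show "sw ` {1..k} \<subseteq> base n j" using \<open>k < j\<close> j(1) by (auto intro!: sw_in_base)
        show "card (sw ` {1..k}) \<le> n" using card_image_le[of "{1..k}" sw] k(1) by (simp add: P_def)
      qed
      finally show False using dominates_slack[OF C(2), of "Suc k"] by simp
    qed
    have "\<exists>m. slack C m < slack S m"
    \<comment> \<open>The growth bound \<open>ext_slack_ge\<close> starts at 4; smaller j are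
      settled by explicit words.\<close>
    proof (cases "j \<ge> 4")
      case True
      then show ?thesis
        using assms(1) j(1) C(1) S(2) opt le_L upto_L total miss
        by (intro slack_deficit_large[where L = L]) auto
    next
      case False
      then obtain m where m: "m \<le> 2 * j + 3" "slack (RR n) m < slack S m"
        using slack_small_witness[OF assms(1) _ _ total, of j] opt j(1) by auto
      have "slack C m \<le> slack (RR n) m"
      proof (rule slack_le_RR[OF C(1)])
        fix i assume "i \<in> {1..n}" "sw i \<notin> C"
        then have "i > j" by (rule miss)
        then have i: "i \<ge> 2" "m + 2 - 2 * i \<le> 3" "m + 2 - 2 * i \<le> m - i" using m(1) j(1) by auto
        then show "i \<ge> 2 \<and> ext_slack (m + 2 - 2 * i) \<le> m - i"
          using ext_slack_le[OF i(2)] by simp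
      qed (use assms(1) in simp)
      then have "slack C m < slack S m" using m(2) by (rule le_less_trans)
      then show ?thesis ..
    qed
    then show ?thesis using dominates_slack[OF C(2)] by (meson not_less)
  qed
  then show ?thesis using assms(2) by (auto simp: DD_def)
qed

end
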